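(* For every real number $\alpha > 0$ there exists a Hamiltonian chordal graph $G$ with a non-extendable cycle $C$ satisfying $|V(C)| < \alpha |V(G)|$.
   Context: All graphs are finite, simple and undirected. A graph is chordal if it has no induced cycle of length $4$ or more. A graph is Hamiltonian if it has a cycle through all its vertices. If $C$ is a cycle of length $m$ in a graph $G$, an extension of $C$ is a cycle $C'$ of length $m+1$ with $V(C')\setminus V(C)=\{v\}$ for a single vertex $v$; $C$ is extendable if it has an extension, and non-extendable otherwise. *)

theory Defs
  imports Complex_Main "Graph_Theory.Graph_Theory"
begin

text \<open>
  A finite simple undirected graph is a \<^locale>\<open>pair_graph\<close>: a finite, loop-free, symmetric set of
  arcs, where an undirected edge is represented by its two opposite arcs.

  A cycle is represented by the list of arcs met when going once around it, so one undirected
  cycle has several representations (choice of starting point and direction). In a symmetric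
  digraph the library's \<^const>\<open>pre_digraph.cycle\<close> also admits the walk \<open>u, v, u\<close> along a single
  edge, hence the length bound below.
\<close>

definition graph_cycle :: "'a pair_pre_digraph \<Rightarrow> ('a \<times> 'a) awalk \<Rightarrow> bool" where
  "graph_cycle G C \<longleftrightarrow> pre_digraph.cycle (with_proj G) C \<and> 3 \<le> length C"

(* every vertex of a closed walk is the tail of one of its arcs *)
definition cycle_verts :: "('a \<times> 'a) awalk \<Rightarrow> 'a set" where
  "cycle_verts C = fst ` set C"

definition induced_cycle :: "'a pair_pre_digraph \<Rightarrow> ('a \<times> 'a) awalk \<Rightarrow> bool" where
  "induced_cycle G C \<longleftrightarrow>
     graph_cycle G C \<and> arcs (with_proj G \<restriction> cycle_verts C) = set C \<union> (set C)\<inverse>"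

definition chordal :: "'a pair_pre_digraph \<Rightarrow> bool" where
  "chordal G \<longleftrightarrow> \<not> (\<exists>C. induced_cycle G C \<and> 4 \<le> length C)"

definition Hamiltonian :: "'a pair_pre_digraph \<Rightarrow> bool" where
  "Hamiltonian G \<longleftrightarrow> (\<exists>C. graph_cycle G C \<and> cycle_verts C = pverts G)"

definition cycle_extension ::
    "'a pair_pre_digraph \<Rightarrow> ('a \<times> 'a) awalk \<Rightarrow> ('a \<times> 'a) awalk \<Rightarrow> bool" where
  "cycle_extension G C C' \<longleftrightarrow>
     graph_cycle G C' \<and> length C' = length C + 1 \<and> (\<exists>v. cycle_verts C' - cycle_verts C = {v})"

definition extendable :: "'a pair_pre_digraph \<Rightarrow> ('a \<times> 'a) awalk \<Rightarrow> bool" where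
  "extendable G C \<longleftrightarrow> (\<exists>C'. cycle_extension G C C')"

end

(*
  Take a Hamiltonian chordal graph on 15 vertices, as found by Lafond and Seamone, with a non-extendable
  cycle C on 13 vertices, and replace one of the two vertices outside C by an arbitrarily
  large clique of twins: this keeps the graph chordal and Hamiltonian, and C stays non-extendable
  because each twin on its own extends C no better than the original vertex.

  Five vertices of C have degree 2, so both their edges lie on every cycle extending C; this leaves
  so few edges at the vertex to be added that following forced edges either gets stuck or closes up
  too early. Chordality holds because the vertices can be ranked such that the neighbours of rank
  at most that of x always form a clique: apply this to a vertex of maximal rank on an induced cycle.
*)

theory Submission
  imports Defs
begin

section \<open>Cycles as lists of vertices\<close>

text \<open>For an open walk, appending the end to the tails gives the same list as prepending the
  start to the heads. When both ends agree, this is a rotation by one.\<close>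

lemma pcas_iff_rotate1:
  "pcas u C u \<longleftrightarrow> C = [] \<or> u = fst (hd C) \<and> map snd C = rotate1 (map fst C)"
proof (cases C)
  case (Cons e es)
  have "pcas a D b \<longleftrightarrow> map fst D @ [b] = a # map snd D" for a b :: 'a and D
    by (induction a D b rule: pcas.induct) auto
  then show ?thesis
    using Cons by auto
qed simp

text \<open>Here \<open>vs\<close> is the list of tails. Distinctness passes between heads and tails
  because one list is a rotation of the other.\<close>

lemma graph_cycle_iff:
  assumes "pair_wf_digraph G"
  shows "graph_cycle G C \<longleftrightarrow>
    (\<exists>vs. C = zip vs (rotate1 vs) \<and> distinct vs \<and> 3 \<le> length vs \<and> set C \<subseteq> parcs G)"
    (is "_ \<longleftrightarrow> ?R")
proof -
  interpret pair_wf_digraph G by fact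
  have vs: "pawalk_verts u C = u # map snd C" if "pcas u C v" for u v
    using that by (induction u C v rule: pcas.induct) auto
  show ?thesis
  proof
    assume "graph_cycle G C"
    then obtain u where u: "pcas u C u" "distinct (map snd C)" "3 \<le> length C" "set C \<subseteq> parcs G"
      using vs by (auto simp: graph_cycle_def cycle_def awalk_def)
    then have r: "map snd C = rotate1 (map fst C)"
      by (auto simp: pcas_iff_rotate1)
    have "C = zip (map fst C) (rotate1 (map fst C))"
      unfolding r[symmetric] by (simp add: zip_map_fst_snd)
    moreover have "distinct (map fst C)"
      using u(2) unfolding r by simp
    ultimately show ?R
      using u by (metis length_map)
  next
    assume ?R
    then obtain vs where C: "C = zip vs (rotate1 vs)" "distinct vs" "3 \<le> length vs" "set C \<subseteq> parcs G"
      by auto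
    have m: "map fst C = vs" "map snd C = rotate1 vs"
      using C(1) by simp_all
    have ne: "C \<noteq> []"
      using m(1) C(3) by auto
    have p: "pcas (fst (hd C)) C (fst (hd C))"
      using m by (simp add: pcas_iff_rotate1)
    moreover have "fst (hd C) \<in> pverts G"
      using C(4) ne by (metis arc_fst_in_verts hd_in_set subsetD)
    ultimately show "graph_cycle G C"
      using vs[OF p] C m ne unfolding graph_cycle_def cycle_def awalk_def
      by (metis distinct1_rotate length_map list.sel(3))
  qed
qed

section \<open>Neighbours along a cycle\<close>

text \<open>The converse is added so that the direction in which \<open>C\<close> is traversed does
  not matter.\<close>

definition cycle_nbrs :: "('a \<times> 'a) awalk \<Rightarrow> 'a \<Rightarrow> 'a set" where
  "cycle_nbrs C x = (set C \<union> (set C)\<inverse>) `` {x}"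

lemma in_cycle_nbrs_sym: "y \<in> cycle_nbrs C x \<longleftrightarrow> x \<in> cycle_nbrs C y"
  by (auto simp: cycle_nbrs_def)

context
  fixes G :: "'a pair_pre_digraph" and C
  assumes wf: "pair_wf_digraph G" and cyc: "graph_cycle G C"
begin

lemma graph_cycle_listE:
  obtains vs where "C = zip vs (rotate1 vs)" "distinct vs" "3 \<le> length vs"
    "cycle_verts C = set vs" "length C = length vs"
    "set C = (\<lambda>i. (vs ! i, vs ! (Suc i mod length vs))) ` {..<length vs}"
proof -
  obtain vs where C: "C = zip vs (rotate1 vs)" "distinct vs" "3 \<le> length vs"
    using cyc by (auto simp: graph_cycle_iff[OF wf])
  moreover have "cycle_verts C = set vs"
    using C(1) unfolding cycle_verts_def by (metis length_rotate1 list.set_map map_fst_zip)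
  moreover have "set C = (\<lambda>i. (vs ! i, vs ! (Suc i mod length vs))) ` {..<length vs}"
    by (force simp: C(1) set_zip nth_rotate1)
  ultimately show ?thesis
    using that by simp
qed

lemma graph_cycle_card: "card (cycle_verts C) = length C"
  by (rule graph_cycle_listE) (simp add: distinct_card)

lemma cycle_nbrs_pair:
  assumes "x \<in> cycle_verts C"
  obtains p s where "p \<noteq> s" "cycle_nbrs C x = {p, s}"
proof (rule graph_cycle_listE)
  fix vs
  assume vs: "distinct vs" "3 \<le> length vs" "cycle_verts C = set vs"
    and C: "set C = (\<lambda>i. (vs ! i, vs ! (Suc i mod length vs))) ` {..<length vs}"
  define n where "n = length vs"
  obtain i where i: "i < n" "x = vs ! i"
    using assms vs by (metis in_set_conv_nth n_def)
  \<comment> \<open>The cyclic predecessor of \<open>i\<close>; the case split avoids truncated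
    subtraction at 0.\<close>
  define j where "j = (if i = 0 then n - 1 else i - 1)"
  have n: "3 \<le> n" "j < n" "Suc i mod n < n"
    using vs i by (auto simp: j_def simp flip: n_def)
  have j: "Suc l mod n = i \<longleftrightarrow> l = j" if "l < n" for l
    using that n i by (cases "Suc l = n") (auto simp: j_def)
  \<comment> \<open>This needs \<open>3 \<le> n\<close>: on two positions, predecessor and successor
    coincide.\<close>
  have ne: "j \<noteq> Suc i mod n"
    using n i by (cases "Suc i = n") (auto simp: j_def split: if_splits)
  have eq: "vs ! a = vs ! b \<longleftrightarrow> a = b" if "a < n" "b < n" for a b
    using that vs(1) by (simp add: n_def nth_eq_iff_index_eq)
  have "y \<in> cycle_nbrs C x \<longleftrightarrow> y = vs ! j \<or> y = vs ! (Suc i mod n)" for y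
  proof -
    have "(x, y) \<in> set C \<longleftrightarrow> y = vs ! (Suc i mod n)"
      using i eq by (auto simp: C n_def[symmetric])
    moreover have "(y, x) \<in> set C \<longleftrightarrow> (\<exists>l<n. y = vs ! l \<and> vs ! i = vs ! (Suc l mod n))"
      using i by (auto simp: C n_def[symmetric])
    then have "(y, x) \<in> set C \<longleftrightarrow> y = vs ! j"
      using n i by (metis eq j mod_less_divisor not_numeral_le_zero not_gr_zero)
    ultimately show ?thesis
      by (auto simp: cycle_nbrs_def)
  qed
  then have "cycle_nbrs C x = {vs ! j, vs ! (Suc i mod n)}"
    by auto
  with ne eq n show thesis
    using that by metis
qed

lemma cycle_nbrs_eq:
  assumes "x \<in> cycle_verts C" "a \<noteq> b" "a \<in> cycle_nbrs C x" "b \<in> cycle_nbrs C x"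
  shows "cycle_nbrs C x = {a, b}"
proof -
  obtain p s where "cycle_nbrs C x = {p, s}"
    using cycle_nbrs_pair[OF assms(1)] by metis
  then show ?thesis
    using assms(2-) by auto
qed

text \<open>The main forcing rule: once only two candidates are left, both must be used.\<close>

lemma cycle_nbrs_eq':
  assumes "x \<in> cycle_verts C" "cycle_nbrs C x \<subseteq> {a, b}"
  shows "cycle_nbrs C x = {a, b}"
proof -
  obtain p s where "p \<noteq> s" "cycle_nbrs C x = {p, s}"
    using cycle_nbrs_pair[OF assms(1)] by metis
  then show ?thesis
    using assms(2) by auto
qed

text \<open>Stepping to successors from \<open>x\<close> stays in \<open>K\<close> and reaches every
  position. This refutes cycles that close up too early.\<close>

lemma cycle_verts_subset_closed:
  assumes K: "x \<in> K" "x \<in> cycle_verts C" and closed: "\<And>y. y \<in> K \<Longrightarrow> cycle_nbrs C y \<subseteq> K"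
  shows "cycle_verts C \<subseteq> K"
proof (rule graph_cycle_listE)
  fix vs
  assume vs: "3 \<le> length vs" "cycle_verts C = set vs"
    and C: "set C = (\<lambda>i. (vs ! i, vs ! (Suc i mod length vs))) ` {..<length vs}"
  define n where "n = length vs"
  obtain i where i: "i < n" "x = vs ! i"
    using K vs by (metis in_set_conv_nth n_def)
  have "vs ! ((i + l) mod n) \<in> K" for l
  proof (induction l)
    case 0
    then show ?case using i K by simp
  next
    case (Suc l)
    have "(vs ! ((i + l) mod n), vs ! (Suc ((i + l) mod n) mod n)) \<in> set C"
      using i unfolding C n_def[symmetric] by (intro image_eqI[OF refl]) simp
    then have "vs ! (Suc ((i + l) mod n) mod n) \<in> cycle_nbrs C (vs ! ((i + l) mod n))"
      by (auto simp: cycle_nbrs_def)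
    then show ?case
      using closed[OF Suc] by (auto simp: mod_simps)
  qed
  moreover have "\<exists>l. (i + l) mod n = j" if "j < n" for j
    using that i by (intro exI[of _ "n - i + j"]) auto
  ultimately show ?thesis
    unfolding vs(2) by (metis in_set_conv_nth n_def subsetI)
qed

end

lemma cycle_nbrs_arcs:
  assumes "pair_graph G" "graph_cycle G C" "y \<in> cycle_nbrs C x"
  shows "(x, y) \<in> parcs G" "x \<in> cycle_verts C" "y \<in> cycle_verts C"
proof -
  interpret pair_graph G by fact
  have wf: "pair_wf_digraph G" ..
  have "set C \<subseteq> parcs G"
    using assms(2) graph_cycle_iff[OF wf] by auto
  then show "(x, y) \<in> parcs G"
    using assms(3) arcs_symmetric by (auto simp: cycle_nbrs_def)
  have "u \<in> cycle_verts C \<and> v \<in> cycle_verts C" if "(u, v) \<in> set C" for u v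
  proof (rule graph_cycle_listE[OF wf assms(2)])
    fix vs
    assume "C = zip vs (rotate1 vs)" "cycle_verts C = set vs"
    then show ?thesis
      using that by (metis set_rotate1 set_zip_leftD set_zip_rightD)
  qed
  then show "x \<in> cycle_verts C" "y \<in> cycle_verts C"
    using assms(3) by (auto simp: cycle_nbrs_def)
qed

section \<open>A criterion for chordality\<close>

text \<open>The two cycle neighbours of a top-ranked vertex are adjacent; on an induced cycle that
  edge belongs to the cycle, which is then a triangle. Ties in rank are allowed, so twins may share
  one.\<close>

lemma chordal_if_ranked:
  fixes r :: "'a \<Rightarrow> nat"
  assumes G: "pair_graph G"
    and clique: "\<And>x y z. (x, y) \<in> parcs G \<Longrightarrow> (x, z) \<in> parcs G \<Longrightarrow> r y \<le> r x \<Longrightarrow> r z \<le> r x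
      \<Longrightarrow> y \<noteq> z \<Longrightarrow> (y, z) \<in> parcs G"
  shows "chordal G"
  unfolding chordal_def
proof safe
  fix C
  assume "induced_cycle G C" and len: "4 \<le> length C"
  then have C: "graph_cycle G C"
    and ind: "arcs (with_proj G \<restriction> cycle_verts C) = set C \<union> (set C)\<inverse>"
    by (auto simp: induced_cycle_def)
  interpret pair_graph G by fact
  have wf: "pair_wf_digraph G" ..
  note nb = cycle_nbrs_arcs[OF G C]
  have fin: "finite (cycle_verts C)"
    by (simp add: cycle_verts_def)
  have "cycle_verts C \<noteq> {}"
    using len by (auto simp: cycle_verts_def)
  then have "Max (r ` cycle_verts C) \<in> r ` cycle_verts C"
    using fin by simp
  then obtain x where x: "x \<in> cycle_verts C" "r x = Max (r ` cycle_verts C)"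
    by (metis imageE)
  then have max: "r y \<le> r x" if "y \<in> cycle_verts C" for y
    using fin that by simp
  obtain p s where ps: "p \<noteq> s" "cycle_nbrs C x = {p, s}"
    by (rule cycle_nbrs_pair[OF wf C x(1)])
  then have arcs: "(x, p) \<in> parcs G" "(x, s) \<in> parcs G" and V: "p \<in> cycle_verts C" "s \<in> cycle_verts C"
    using nb by blast+
  then have "(p, s) \<in> parcs G"
    using clique[OF arcs] max ps(1) by simp
  then have "(p, s) \<in> set C \<union> (set C)\<inverse>"
    using V unfolding ind[symmetric] by (simp add: induce_subgraph_def)
  then have "s \<in> cycle_nbrs C p"
    by (auto simp: cycle_nbrs_def)
  moreover have "x \<noteq> p" "x \<noteq> s"
    using arcs no_loops' by blast+
  ultimately have "cycle_nbrs C p = {x, s}" "cycle_nbrs C s = {x, p}"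
    using V ps cycle_nbrs_eq[OF wf C] in_cycle_nbrs_sym by (metis insertCI)+
  with ps have "cycle_verts C \<subseteq> {x, p, s}"
    using x(1) by (intro cycle_verts_subset_closed[OF wf C, of x]) auto
  then have "card (cycle_verts C) \<le> card {x, p, s}"
    by (intro card_mono) auto
  also have "\<dots> \<le> 3"
    by (simp add: card_insert_if)
  finally show False
    using len graph_cycle_card[OF wf C] by simp
qed

text \<open>With \<open>successively\<close>, arcs can be checked segment by segment, also when one
  segment has symbolic length.\<close>

lemma set_zip_rotate1_subset_iff:
  "set (zip (x # xs) (rotate1 (x # xs))) \<subseteq> A \<longleftrightarrow> successively (\<lambda>u v. (u, v) \<in> A) (x # xs @ [x])"
proof -
  have "set (zip (y # xs) (xs @ [x])) \<subseteq> A \<longleftrightarrow> successively (\<lambda>u v. (u, v) \<in> A) (y # xs @ [x])" for y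
    by (induction xs arbitrary: y) auto
  then show ?thesis by simp
qed

section \<open>The graph\<close>

text \<open>
  Labels \<open>9, \<dots>, 13\<close> are the vertices of degree 2; the label 14 stands for the class of twins, and
  \<open>min x 14\<close> is the label of the vertex \<open>x\<close> of the blown-up graph. A label lists those neighbours that
  precede it in a perfect elimination ordering read backwards, in which 14 comes between 3 and 6;
  14 lists itself because twins are adjacent.
\<close>

definition earlier :: "nat \<Rightarrow> nat set" where
  "earlier a = [{}, {0}, {0,1}, {0,1,2}, {0,1,2,3}, {0,1,3,4}, {0,1,2,14}, {0,1,2,6}, {0,1,2,7},
    {0,5}, {0,7}, {1,8}, {1,4}, {2,3}, {0,1,2,3,14}] ! a"

definition adj :: "nat \<Rightarrow> nat \<Rightarrow> bool" where
  "adj a b \<longleftrightarrow> b \<in> earlier a \<or> a \<in> earlier b"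

text \<open>The twins are 14, ..., 14 + k, so \<open>k = 0\<close> gives the base graph. The
  condition \<open>x \<noteq> y\<close> removes the loops caused by 14 listing itself.\<close>

definition twin_graph :: "nat \<Rightarrow> nat pair_pre_digraph" where
  "twin_graph k = \<lparr>pverts = {..<15 + k},
    parcs = {(x, y). x < 15 + k \<and> y < 15 + k \<and> x \<noteq> y \<and> adj (min x 14) (min y 14)}\<rparr>"

lemma pair_graph_twin_graph: "pair_graph (twin_graph k)"
proof
  show "finite (parcs (twin_graph k))"
    by (rule finite_subset[of _ "{..<15 + k} \<times> {..<15 + k}"]) (auto simp: twin_graph_def)
  show "symmetric (with_proj (twin_graph k))"
    by (auto simp: symmetric_def sym_def twin_graph_def adj_def)
qed (auto simp: twin_graph_def)

lemma pair_wf_digraph_twin_graph: "pair_wf_digraph (twin_graph k)"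
  using pair_graph_twin_graph by (simp add: pair_graph_def pair_digraph_def pair_fin_digraph_def)

lemma chordal_twin_graph: "chordal (twin_graph k)"
proof (rule chordal_if_ranked[OF pair_graph_twin_graph])
  \<comment> \<open>Twins rank above 0 to 3 and below 6, the only other label listing 14. Sharing
    rank 4 with label 4 is harmless, since 4 and 14 are not adjacent.\<close>
  let ?r = "\<lambda>x::nat. if x < 14 then x else 4"
  have rank: "\<forall>a\<in>{..<15}. \<forall>b\<in>earlier a. ?r b < ?r a \<or> a = 14 \<and> b = 14"
    by (simp add: lessThan_nat_numeral earlier_def)
  have clique: "\<forall>a\<in>{..<15}. \<forall>b\<in>earlier a. \<forall>c\<in>earlier a. b = c \<or> adj b c"
    by (simp add: lessThan_nat_numeral earlier_def adj_def)
  have twins: "adj 14 14"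
    by (simp add: earlier_def adj_def)
  \<comment> \<open>Otherwise \<open>a\<close> is in \<open>earlier b\<close>, and
    \<open>rank\<close> makes \<open>a\<close> strictly lower unless both are 14, which lists
    itself.\<close>
  have *: "b \<in> earlier a" if "adj a b" "?r b \<le> ?r a" "a < 15" "b < 15" for a b
    using that rank unfolding adj_def by fastforce
  fix x y z
  assume xyz: "(x, y) \<in> parcs (twin_graph k)" "(x, z) \<in> parcs (twin_graph k)" "?r y \<le> ?r x" "?r z \<le> ?r x" "y \<noteq> z"
  have r: "?r (min u 14) = ?r u" for u
    by auto
  have "min y 14 \<in> earlier (min x 14)" "min z 14 \<in> earlier (min x 14)"
    using xyz by (auto simp: twin_graph_def simp del: min_less_iff_conj intro!: * simp: r)
  then have "min y 14 = min z 14 \<or> adj (min y 14) (min z 14)"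
    using clique[rule_format, of "min x 14"] by auto
  \<comment> \<open>Distinct vertices with equal labels are twins.\<close>
  then have "adj (min y 14) (min z 14)"
    using xyz(5) twins by (auto simp: min_def split: if_splits)
  then show "(y, z) \<in> parcs (twin_graph k)"
    using xyz by (simp add: twin_graph_def)
qed

lemma Hamiltonian_twin_graph: "Hamiltonian (twin_graph k)"
proof -
  \<comment> \<open>From 6 the cycle runs through all twins to 3, then through the remaining
    vertices to 7, a neighbour of 6.\<close>
  define ws :: "nat list" where "ws = [14..<15 + k] @ [3,13,2,8,11,1,12,4,5,9,0,10,7]"
  let ?C = "zip (6 # ws) (rotate1 (6 # ws))"
  have "successively (\<lambda>u v. (u, v) \<in> parcs (twin_graph k)) [14..<15 + k]"
    by (auto simp: successively_conv_nth twin_graph_def adj_def earlier_def)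
  then have "set ?C \<subseteq> parcs (twin_graph k)"
    unfolding set_zip_rotate1_subset_iff
    by (simp add: ws_def successively_append_iff successively_Cons)
      (simp add: twin_graph_def adj_def earlier_def)
  moreover have "distinct (6 # ws)" "3 \<le> length (6 # ws)"
    by (auto simp: ws_def)
  ultimately have "graph_cycle (twin_graph k) ?C"
    using graph_cycle_iff[OF pair_wf_digraph_twin_graph] by metis
  moreover have "cycle_verts ?C = set (6 # ws)"
    unfolding cycle_verts_def by (metis length_rotate1 list.set_map map_fst_zip)
  moreover have "set (6 # ws) = {..<15 + k}"
    unfolding ws_def by auto presburger
  ultimately show ?thesis
    unfolding Hamiltonian_def by (intro exI[of _ ?C] conjI)
      (simp_all only: twin_graph_def pair_pre_digraph.simps)
qed

section \<open>The non-extendable cycle\<close>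

text \<open>It avoids exactly 6 and the twins, so its length stays 13 for every
  \<open>k\<close>.\<close>

definition short_cycle :: "(nat \<times> nat) awalk" where
  "short_cycle = (let vs = [5,9,0,10,7,8,11,1,12,4,2,13,3] in zip vs (rotate1 vs))"

lemma cycle_verts_short_cycle: "cycle_verts short_cycle = {0,1,2,3,4,5,7,8,9,10,11,12,13}"
  by (auto simp: cycle_verts_def short_cycle_def)

lemma graph_cycle_short_cycle: "graph_cycle (twin_graph k) short_cycle"
proof -
  have "set short_cycle \<subseteq> parcs (twin_graph k)"
    by (simp add: short_cycle_def twin_graph_def adj_def earlier_def)
  then show ?thesis
    unfolding graph_cycle_iff[OF pair_wf_digraph_twin_graph]
    by (intro exI[of _ "[5,9,0,10,7,8,11,1,12,4,2,13,3]"]) (simp add: short_cycle_def)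
qed

lemma not_extendable_short_cycle: "\<not> extendable (twin_graph k) short_cycle"
proof
  let ?G = "twin_graph k" and ?W = "{0,1,2,3,4,5,7,8,9,10,11,12,13::nat}"
  assume "extendable ?G short_cycle"
  then obtain C v where C: "graph_cycle ?G C" and "length C = length short_cycle + 1"
    and v: "cycle_verts C - ?W = {v}"
    unfolding extendable_def cycle_extension_def cycle_verts_short_cycle by blast
  then have len: "length C = 14"
    by (simp add: short_cycle_def)
  note wf = pair_wf_digraph_twin_graph
  note nb = cycle_nbrs_arcs[OF pair_graph_twin_graph C]
  note eq = cycle_nbrs_eq[OF wf C] and eq' = cycle_nbrs_eq'[OF wf C]
  \<comment> \<open>An extension is only required to have one new vertex; counting 14 = 13 + 1 shows
    that no old vertex is lost.\<close>
  have V: "cycle_verts C = insert v ?W"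
  proof (rule card_subset_eq)
    show "cycle_verts C \<subseteq> insert v ?W"
      using v by blast
    have "v \<notin> ?W"
      using v by blast
    then show "card (cycle_verts C) = card (insert v ?W)"
      using graph_cycle_card[OF wf C] len by simp
  qed simp
  have adjD: "y \<in> cycle_verts C \<and> x \<noteq> y \<and> adj (min x 14) (min y 14)" if "y \<in> cycle_nbrs C x" for x y
    using nb[OF that] by (auto simp: twin_graph_def)
  have "{..<14} = insert 6 ?W"
    by (auto simp: lessThan_nat_numeral)
  moreover have "v \<notin> ?W"
    using v by blast
  ultimately have v_cases: "v = 6 \<or> 14 \<le> v"
    by (metis insertE lessThan_iff not_le)
  have sub: "cycle_nbrs C x \<subseteq> {y \<in> insert v ?W. x \<noteq> y \<and> adj (min x 14) (min y 14)}" for x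
    using adjD V by auto
  have deg2: "cycle_nbrs C 9 = {0,5}" "cycle_nbrs C 10 = {0,7}" "cycle_nbrs C 11 = {1,8}"
    "cycle_nbrs C 12 = {1,4}" "cycle_nbrs C 13 = {2,3}"
    using v_cases by (intro eq'; use V in simp; intro order_trans[OF sub];
        auto simp: adj_def earlier_def min_def)+
  have n0: "cycle_nbrs C 0 = {9,10}" and n1: "cycle_nbrs C 1 = {11,12}"
    using deg2 by (intro eq; use V in_cycle_nbrs_sym in fastforce)+
  have t: "13 \<in> cycle_nbrs C 2" "13 \<in> cycle_nbrs C 3" "10 \<in> cycle_nbrs C 7"
    using deg2 in_cycle_nbrs_sym by (metis insertCI)+
  have n01: "0 \<notin> cycle_nbrs C x" "1 \<notin> cycle_nbrs C x" if "x \<notin> {9,10,11,12}" for x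
    using that n0 n1 in_cycle_nbrs_sym by (metis insertE insertCI singletonD)+
  show False
  proof (cases "v = 6")
    \<comment> \<open>6 must be joined to 2 and 7, which are then saturated, leaving 8 with 11 as
      its only possible neighbour.\<close>
    case True
    have "cycle_nbrs C 6 \<subseteq> {0,1,2,7}"
      using True by (intro order_trans[OF sub]) (auto simp: adj_def earlier_def min_def)
    then have "cycle_nbrs C 6 = {2,7}"
      using n01[of 6] True V by (intro eq') auto
    then have "6 \<in> cycle_nbrs C 2" "6 \<in> cycle_nbrs C 7"
      using in_cycle_nbrs_sym by (metis insertCI)+
    then have "cycle_nbrs C 2 = {6,13}" "cycle_nbrs C 7 = {6,10}"
      using t V by (intro eq; auto)+
    then have "2 \<notin> cycle_nbrs C 8" "7 \<notin> cycle_nbrs C 8"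
      by (simp_all add: in_cycle_nbrs_sym[of _ _ 8])
    moreover have "cycle_nbrs C 8 \<subseteq> {0,1,2,7,11}"
      using True by (intro order_trans[OF sub]) (auto simp: adj_def earlier_def min_def)
    ultimately have "cycle_nbrs C 8 \<subseteq> {11}"
      using n01[of 8] by auto
    moreover have "8 \<in> cycle_verts C"
      using V by simp
    ultimately show False
      using cycle_nbrs_pair[OF wf C] by (metis insert_subset singletonD)
  next
    \<comment> \<open>The twin \<open>v\<close> must be joined to 2 and 3, and so is 13: the cycle
      closes up as \<open>v\<close>, 2, 13, 3.\<close>
    case False
    then have v: "14 \<le> v"
      using v_cases by simp
    then have "cycle_nbrs C v \<subseteq> {0,1,2,3}"
      by (intro order_trans[OF sub]) (auto simp: adj_def earlier_def min_def)
    then have nv: "cycle_nbrs C v = {2,3}"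
      using n01[of v] v V by (intro eq') auto
    then have "v \<in> cycle_nbrs C 2" "v \<in> cycle_nbrs C 3"
      using in_cycle_nbrs_sym by (metis insertCI)+
    then have "cycle_nbrs C 2 = {v,13}" "cycle_nbrs C 3 = {v,13}"
      using t V v by (intro eq; auto)+
    with nv deg2 have "cycle_verts C \<subseteq> {v,2,3,13}"
      using V by (intro cycle_verts_subset_closed[OF wf C, of v]) auto
    then show False
      using V v by auto
  qed
qed

theorem theorem2p3:
  fixes \<alpha> :: real
  assumes "\<alpha> > 0"
  shows "\<exists>(G :: nat pair_pre_digraph) C.
           pair_graph G \<and> Hamiltonian G \<and> chordal G \<and>
           graph_cycle G C \<and> \<not> extendable G C \<and>
           real (card (cycle_verts C)) < \<alpha> * real (card (pverts G))"
proof -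
  \<comment> \<open>The ratio to be bounded is 13 / (15 + k).\<close>
  obtain k :: nat where "13 / \<alpha> < real k"
    using reals_Archimedean2 by blast
  then have "13 < \<alpha> * real (15 + k)"
    using assms by (simp add: field_simps add_pos_pos)
  then have "real (card (cycle_verts short_cycle)) < \<alpha> * real (card (pverts (twin_graph k)))"
    by (simp add: cycle_verts_short_cycle twin_graph_def)
  then show ?thesis
    using pair_graph_twin_graph Hamiltonian_twin_graph chordal_twin_graph
      graph_cycle_short_cycle not_extendable_short_cycle by blast
qed

end
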